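(* Let $X\subseteq\mathbb{R}^m$ and $Y\subseteq\mathbb{R}$ be bounded open sets, $m>1$, let $c\in C^2(\overline X\times\overline Y)$ be twisted and non-degenerate, and let $\mu$ and $\nu$ be probability measures on $X$ and $Y$, absolutely continuous with respect to Lebesgue measure, with densities $\bar\mu$ and $\bar\nu$. For $y_0<y_1$ in $Y$ write $S(y_0,y_1)=X_\ge(y_1,k_{max}(y_0,y_1,k(y_0)))\setminus X_\ge(y_0,k(y_0))$. Suppose that for all $y_0\in Y$, $$\sup_{y_1\in Y,\ y_1>y_0,\ y_0\le y\le y_1}\left[\|\bar\mu\|_{L^\infty(S(y_0,y_1))}\,\frac{D^{min}_{vol}(y_0,y_1,k(y_0))}{y_1-y_0}-\bar\nu(y)\right]<0.$$ Then $(c,\mu,\nu)$ is nested.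
   Context: Twisted: for each $x\in X$ the map $y\mapsto D_xc(x,y)$ is injective on $Y$. Non-degenerate (one-dimensional target): $D^2_{xy}c(x,y)\neq 0$ for all $(x,y)\in\overline X\times\overline Y$. For $y\in Y$ and $k\in\mathbb{R}$: $X_=(y,k)=\{x\in X:\frac{\partial c}{\partial y}(x,y)=k\}$, $X_\ge(y,k)=\{x\in X:\frac{\partial c}{\partial y}(x,y)\ge k\}$, $X_>(y,k)=X_\ge(y,k)\setminus X_=(y,k)$. The mass-splitting level $k(y)\in\mathbb{R}$, $y\in Y$, is defined by $\mu(X_\ge(y,k(y)))=\nu((-\infty,y])$ (if this does not determine $k(y)$ uniquely, $k$ denotes a fixed choice). The model $(c,\mu,\nu)$ is nested if for all $y_0<y_1$ in $Y$: $\nu([y_0,y_1])>0$ implies $X_\ge(y_0,k(y_0))\subseteq X_>(y_1,k(y_1))$. For $y_0<y_1$ in $Y$ and $k_0$ set $k_{max}(y_0,y_1,k_0)=\sup\{k: X_\ge(y_0,k_0)\subseteq X_\ge(y_1,k)\}$, and $D^{min}_{vol}(y_0,y_1,k_0)=\mathrm{vol}\big(X_\ge(y_1,k_{max}(y_0,y_1,k_0))\setminus X_\ge(y_0,k_0)\big)$, where $\mathrm{vol}$ is Lebesgue measure on $\mathbb{R}^m$ (if $X_\ge(y_0,k_0)=\emptyset$ then $k_{max}=+\infty$, $X_\ge(y_1,+\infty)=\emptyset$ and this quantity is $0$). The density $\bar\nu$ is extended by zero outside $Y$. *)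

theory Defs
  imports "HOL-Probability.Probability"
begin

text \<open>
  The class of $C^2$ functions on the closure of an open set \<open>U\<close>: the function and its derivatives
  of order one and two in \<open>U\<close> extend continuously to the closure. Differentiability is required
  in \<open>U\<close> only; \<open>f'\<close> and \<open>f''\<close> are the continuous extensions.
\<close>

definition C2_on_closure :: "'a::euclidean_space set \<Rightarrow> ('a \<Rightarrow> real) \<Rightarrow> bool" where
  "C2_on_closure U f \<longleftrightarrow>
     (\<exists>(f' :: 'a \<Rightarrow> 'a \<Rightarrow>\<^sub>L real) (f'' :: 'a \<Rightarrow> 'a \<Rightarrow>\<^sub>L 'a \<Rightarrow>\<^sub>L real).
        continuous_on (closure U) f \<and> continuous_on (closure U) f' \<and> continuous_on (closure U) f'' \<and>
        (\<forall>x\<in>U. (f has_derivative blinfun_apply (f' x)) (at x) \<and>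
               (f' has_derivative blinfun_apply (f'' x)) (at x)))"

definition grad :: "('a::real_inner \<Rightarrow> real) \<Rightarrow> 'a \<Rightarrow> 'a" where
  "grad f x = (THE D. GDERIV f x :> D)"

definition Dx :: "('a::euclidean_space \<Rightarrow> real \<Rightarrow> real) \<Rightarrow> 'a \<Rightarrow> real \<Rightarrow> 'a" where
  "Dx c x y = grad (\<lambda>x'. c x' y) x"

definition Dy :: "('a::euclidean_space \<Rightarrow> real \<Rightarrow> real) \<Rightarrow> 'a \<Rightarrow> real \<Rightarrow> real" where
  "Dy c x y = deriv (c x) y"

definition Dxy :: "('a::euclidean_space \<Rightarrow> real \<Rightarrow> real) \<Rightarrow> 'a \<Rightarrow> real \<Rightarrow> 'a" where
  "Dxy c x y = grad (\<lambda>x'. Dy c x' y) x"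

text \<open>
  The continuous extension of the mixed derivative from \<open>X \<times> Y\<close> to its closure; for a cost that is
  $C^2$ up to the boundary this limit exists, and it is the derivative itself on the open set
  \<open>X \<times> Y\<close>.
\<close>

definition Dxy_ext ::
  "'a::euclidean_space set \<Rightarrow> real set \<Rightarrow> ('a \<Rightarrow> real \<Rightarrow> real) \<Rightarrow> 'a \<Rightarrow> real \<Rightarrow> 'a" where
  "Dxy_ext X Y c x y = Lim (at (x, y) within X \<times> Y) (\<lambda>(x', y'). Dxy c x' y')"

definition twisted ::
  "'a::euclidean_space set \<Rightarrow> real set \<Rightarrow> ('a \<Rightarrow> real \<Rightarrow> real) \<Rightarrow> bool" where
  "twisted X Y c \<longleftrightarrow> (\<forall>x\<in>X. inj_on (Dx c x) Y)"

definition nondegenerate ::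
  "'a::euclidean_space set \<Rightarrow> real set \<Rightarrow> ('a \<Rightarrow> real \<Rightarrow> real) \<Rightarrow> bool" where
  "nondegenerate X Y c \<longleftrightarrow> (\<forall>x\<in>closure X. \<forall>y\<in>closure Y. Dxy_ext X Y c x y \<noteq> 0)"

text \<open>
  Levels are extended reals so that the level \<open>\<infinity>\<close>, with empty superlevel set, is available as a
  value of \<open>k_max\<close>.
\<close>

definition X_eq ::
  "'a::euclidean_space set \<Rightarrow> ('a \<Rightarrow> real \<Rightarrow> real) \<Rightarrow> real \<Rightarrow> ereal \<Rightarrow> 'a set" where
  "X_eq X c y k = {x\<in>X. ereal (Dy c x y) = k}"

definition X_ge ::
  "'a::euclidean_space set \<Rightarrow> ('a \<Rightarrow> real \<Rightarrow> real) \<Rightarrow> real \<Rightarrow> ereal \<Rightarrow> 'a set" where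
  "X_ge X c y k = {x\<in>X. ereal (Dy c x y) \<ge> k}"

definition X_gt ::
  "'a::euclidean_space set \<Rightarrow> ('a \<Rightarrow> real \<Rightarrow> real) \<Rightarrow> real \<Rightarrow> ereal \<Rightarrow> 'a set" where
  "X_gt X c y k = X_ge X c y k - X_eq X c y k"

definition mass_splitting ::
  "'a::euclidean_space set \<Rightarrow> real set \<Rightarrow> ('a \<Rightarrow> real \<Rightarrow> real) \<Rightarrow> 'a measure \<Rightarrow> real measure \<Rightarrow>
   (real \<Rightarrow> real) \<Rightarrow> bool" where
  "mass_splitting X Y c \<mu> \<nu> k \<longleftrightarrow> (\<forall>y\<in>Y. emeasure \<mu> (X_ge X c y (k y)) = emeasure \<nu> {..y})"

text \<open>The measure on \<open>X\<close> enters only through the chosen mass-splitting level \<open>k\<close>.\<close>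

definition nested ::
  "'a::euclidean_space set \<Rightarrow> real set \<Rightarrow> ('a \<Rightarrow> real \<Rightarrow> real) \<Rightarrow> real measure \<Rightarrow>
   (real \<Rightarrow> real) \<Rightarrow> bool" where
  "nested X Y c \<nu> k \<longleftrightarrow>
     (\<forall>y0\<in>Y. \<forall>y1\<in>Y. y0 < y1 \<longrightarrow> emeasure \<nu> {y0..y1} > 0 \<longrightarrow>
        X_ge X c y0 (k y0) \<subseteq> X_gt X c y1 (k y1))"

definition k_max ::
  "'a::euclidean_space set \<Rightarrow> ('a \<Rightarrow> real \<Rightarrow> real) \<Rightarrow> real \<Rightarrow> real \<Rightarrow> real \<Rightarrow> ereal" where
  "k_max X c y0 y1 k0 = (SUP k\<in>{k::real. X_ge X c y0 k0 \<subseteq> X_ge X c y1 k}. ereal k)"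

definition S_min ::
  "'a::euclidean_space set \<Rightarrow> ('a \<Rightarrow> real \<Rightarrow> real) \<Rightarrow> real \<Rightarrow> real \<Rightarrow> real \<Rightarrow> 'a set" where
  "S_min X c y0 y1 k0 = X_ge X c y1 (k_max X c y0 y1 k0) - X_ge X c y0 k0"

definition D_vol_min ::
  "'a::euclidean_space set \<Rightarrow> ('a \<Rightarrow> real \<Rightarrow> real) \<Rightarrow> real \<Rightarrow> real \<Rightarrow> real \<Rightarrow> ennreal" where
  "D_vol_min X c y0 y1 k0 = emeasure lborel (S_min X c y0 y1 k0)"

text \<open>
  Taking the essential supremum in \<^typ>\<open>ennreal\<close> makes the norm over a null set \<open>0\<close>
  (in \<^typ>\<open>ereal\<close> it would be \<open>-\<infinity>\<close>).
\<close>

definition Linf_norm :: "'a::euclidean_space set \<Rightarrow> ('a \<Rightarrow> real) \<Rightarrow> ennreal" where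
  "Linf_norm S f = esssup (restrict_space lborel S) (\<lambda>x. ennreal \<bar>f x\<bar>)"

end

theory Submission
  imports Defs
begin

text \<open>
  The hypothesis bounds the mass of \<open>S(y\<^sub>0, y\<^sub>1)\<close> by its volume times the norm of the density, and hence
  strictly by the mass of \<open>(y\<^sub>0, y\<^sub>1]\<close>. So the superlevel set of \<open>y\<^sub>1\<close> at level \<open>k_max\<close>, which is
  the smallest one containing that of \<open>y\<^sub>0\<close>, carries less mass than the superlevel set at the
  mass-splitting level \<open>k y\<^sub>1\<close>. Therefore \<open>k y\<^sub>1 < k_max\<close>, which is nestedness.
\<close>

text \<open>By the chain rule along \<open>t \<mapsto> (x, t)\<close>, the partial derivative in
  \<open>y\<close> is the total derivative \<open>f' (x, y)\<close> applied to
  \<open>(0, 1)\<close>, and \<open>f'\<close> is continuous. This is what makes the superlevel sets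
  Borel.\<close>

lemma Dy_continuous_on:
  fixes c :: "'a::euclidean_space \<Rightarrow> real \<Rightarrow> real"
  assumes "C2_on_closure (X \<times> Y) (\<lambda>(x, y). c x y)" and y: "y \<in> Y"
  shows "continuous_on X (\<lambda>x. Dy c x y)"
proof -
  obtain f' :: "'a \<times> real \<Rightarrow> ('a \<times> real) \<Rightarrow>\<^sub>L real"
    where cont: "continuous_on (closure (X \<times> Y)) f'"
      and der: "\<And>z. z \<in> X \<times> Y \<Longrightarrow> ((\<lambda>(x, y). c x y) has_derivative blinfun_apply (f' z)) (at z)"
    using assms(1) unfolding C2_on_closure_def by (elim exE conjE) (rule that, auto)
  have Dy_eq: "Dy c x y = f' (x, y) (0, 1)" if "x \<in> X" for x
  proof -
    have "((\<lambda>t. (x, t)) has_derivative (\<lambda>h. (0, h))) (at y)"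
      by (auto intro!: derivative_eq_intros)
    from diff_chain_at[OF this der] that y
    have "(c x has_derivative (\<lambda>h. f' (x, y) (0, h))) (at y)"
      by (simp add: o_def)
    moreover have "(\<lambda>h. f' (x, y) (0, h)) = (*) (f' (x, y) (0, 1))"
    proof
      show "f' (x, y) (0, h) = f' (x, y) (0, 1) * h" for h
        using blinfun.scaleR_right[of "f' (x, y)" h "(0, 1)"] by (simp add: mult.commute)
    qed
    ultimately have "(c x has_field_derivative f' (x, y) (0, 1)) (at y)"
      by (simp add: has_field_derivative_def)
    then show ?thesis
      unfolding Dy_def by (rule DERIV_imp_deriv)
  qed
  have "continuous_on X (\<lambda>x. f' (x, y))"
    by (rule continuous_on_compose2[OF cont])
       (use y closure_subset[of "X \<times> Y"] in \<open>auto intro!: continuous_intros\<close>)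
  then have "continuous_on X (\<lambda>x. f' (x, y) (0, 1))"
    by (intro continuous_intros)
  then show ?thesis
    by (simp add: Dy_eq cong: continuous_on_cong)
qed

lemma X_ge_borel:
  assumes "open X" "continuous_on X (\<lambda>x. Dy c x y)"
  shows "X_ge X c y k \<in> sets borel"
proof -
  have "(\<lambda>x. ereal (Dy c x y)) \<in> borel_measurable (restrict_space borel X)"
    using borel_measurable_continuous_on_restrict[OF assms(2)] by simp
  then have "{x \<in> space (restrict_space borel X). k \<le> ereal (Dy c x y)}
      \<in> sets (restrict_space borel X)"
    by measurable
  moreover have "{x \<in> space (restrict_space borel X). k \<le> ereal (Dy c x y)} = X_ge X c y k"
    by (auto simp: X_ge_def space_restrict_space)
  ultimately show ?thesis
    using \<open>open X\<close> by (simp add: sets_restrict_space_iff)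
qed

text \<open>The supremum is attained: at a point of the left-hand set every admissible level is at
  most \<open>Dy c x y1\<close>, hence so is their supremum. An infinite \<open>k_max\<close> is
  covered by the same argument.\<close>

lemma X_ge_subset_k_max:
  "X_ge X c y0 (ereal k0) \<subseteq> X_ge X c y1 (k_max X c y0 y1 k0)"
  by (auto simp: X_ge_def k_max_def intro!: SUP_least)

lemma emeasure_density_le_Linf_norm:
  assumes [measurable]: "f \<in> borel_measurable lborel" and S: "S \<in> sets borel"
  shows "emeasure (density lborel (\<lambda>x. ennreal (f x))) S \<le> Linf_norm S f * emeasure lborel S"
proof -
  have "AE x in restrict_space lborel S. ennreal \<bar>f x\<bar> \<le> Linf_norm S f"
    unfolding Linf_norm_def
    by (rule esssup_AE)
  then have AE: "AE x in lborel. x \<in> S \<longrightarrow> ennreal \<bar>f x\<bar> \<le> Linf_norm S f"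
    using S by (subst (asm) AE_restrict_space_iff) auto
  have "emeasure (density lborel (\<lambda>x. ennreal (f x))) S
      = (\<integral>\<^sup>+x. ennreal (f x) * indicator S x \<partial>lborel)"
    using S by (simp add: emeasure_density)
  also have "\<dots> \<le> (\<integral>\<^sup>+x. Linf_norm S f * indicator S x \<partial>lborel)"
    \<comment> \<open>The norm bounds \<open>\<bar>f x\<bar>\<close>, which dominates
      \<open>f x\<close> whatever its sign.\<close>
    using AE by (intro nn_integral_mono_AE, eventually_elim)
      (auto simp: indicator_def intro: order_trans[OF ennreal_leI[OF abs_ge_self]])
  also have "\<dots> = Linf_norm S f * emeasure lborel S"
    using S by (simp add: nn_integral_cmult_indicator)
  finally show ?thesis .
qed

text \<open>A strictly negative supremum leaves a gap \<open>d > 0\<close> that is uniform in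
  \<open>y\<close>, so \<open>f\<close> is at least \<open>r + d\<close> on the whole interval.
  Integration gains at least \<open>d * (b - a) > 0\<close> over \<open>r * (b - a)\<close>.\<close>

lemma emeasure_density_Ioc_greater:
  fixes r :: ennreal and f :: "real \<Rightarrow> real"
  assumes [measurable]: "f \<in> borel_measurable lborel"
    and "a < b"
    and less: "(SUP y \<in> {a..b}. enn2ereal r - ereal (f y)) < 0"
  shows "r * ennreal (b - a) < emeasure (density lborel (\<lambda>y. ennreal (f y))) {a<..b}"
proof -
  obtain e where e: "(SUP y \<in> {a..b}. enn2ereal r - ereal (f y)) < e" "e < 0"
    using dense[OF less] by blast
  have bound: "enn2ereal r - ereal (f y) < e" if "y \<in> {a..b}" for y
    using e(1) that by (meson SUP_upper le_less_trans)
  \<comment> \<open>An infinite \<open>r\<close> would make the difference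
    \<open>\<infinity>\<close> at \<open>y = a\<close>, as \<open>f a\<close> is real.\<close>
  have "r \<noteq> \<infinity>"
    using bound[of a] e(2) \<open>a < b\<close> by auto
  then obtain r' where r: "r = ennreal r'" "r' \<ge> 0"
    by (metis ennreal_cases infinity_ennreal_def)
  \<comment> \<open>Nothing lies strictly below \<open>-\<infinity>\<close>, but the difference at
    \<open>y = a\<close> lies below \<open>e\<close>.\<close>
  have "e \<noteq> -\<infinity>"
    using bound[of a] \<open>a < b\<close> by auto
  then obtain d where d: "e = ereal (- d)" "d > 0"
    using e(2) by (cases e) (auto intro: that[of "- real_of_ereal e"])
  have le: "r' + d \<le> f y" if "y \<in> {a..b}" for y
    using bound[OF that] r d by (simp add: enn2ereal_ennreal)
  have "r * ennreal (b - a) = ennreal (r' * (b - a))"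
    using r \<open>a < b\<close> by (simp add: ennreal_mult)
  also have "\<dots> < ennreal ((r' + d) * (b - a))"
    using r d \<open>a < b\<close> by (intro ennreal_lessI) auto
  also have "\<dots> = (\<integral>\<^sup>+y. ennreal (r' + d) * indicator {a<..b} y \<partial>lborel)"
    using r d \<open>a < b\<close> by (simp add: nn_integral_cmult_indicator ennreal_mult)
  also have "\<dots> \<le> (\<integral>\<^sup>+y. ennreal (f y) * indicator {a<..b} y \<partial>lborel)"
    by (intro nn_integral_mono) (auto simp: indicator_def intro!: ennreal_leI le)
  also have "\<dots> = emeasure (density lborel (\<lambda>y. ennreal (f y))) {a<..b}"
    by (simp add: emeasure_density)
  finally show ?thesis .
qed

theorem corollary7:
  fixes X :: "(real ^ 'm) set" and Y :: "real set"
    and c :: "real ^ 'm \<Rightarrow> real \<Rightarrow> real"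
    and \<mu> :: "(real ^ 'm) measure" and \<nu> :: "real measure"
    and \<mu>_bar :: "real ^ 'm \<Rightarrow> real" and \<nu>_bar :: "real \<Rightarrow> real"
    and k :: "real \<Rightarrow> real"
  assumes "CARD('m) > 1"
    and "open X" "bounded X" "open Y" "bounded Y"
    and "C2_on_closure (X \<times> Y) (\<lambda>(x, y). c x y)"
    and "twisted X Y c" and "nondegenerate X Y c"
    and "prob_space \<mu>" and "prob_space \<nu>"
    and "\<mu>_bar \<in> borel_measurable lborel" "\<And>x. \<mu>_bar x \<ge> 0" "\<And>x. x \<notin> X \<Longrightarrow> \<mu>_bar x = 0"
    and "\<mu> = density lborel (\<lambda>x. ennreal (\<mu>_bar x))"
    and "\<nu>_bar \<in> borel_measurable lborel" "\<And>y. \<nu>_bar y \<ge> 0" "\<And>y. y \<notin> Y \<Longrightarrow> \<nu>_bar y = 0"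
    and "\<nu> = density lborel (\<lambda>y. ennreal (\<nu>_bar y))"
    and "mass_splitting X Y c \<mu> \<nu> k"
    and "\<And>y0. y0 \<in> Y \<Longrightarrow>
      (SUP (y1, y) \<in> {(y1, y). y1 \<in> Y \<and> y1 > y0 \<and> y0 \<le> y \<and> y \<le> y1}.
         enn2ereal (Linf_norm (S_min X c y0 y1 (k y0)) \<mu>_bar *
                    (D_vol_min X c y0 y1 (k y0) / ennreal (y1 - y0))) - ereal (\<nu>_bar y)) < 0"
  shows "nested X Y c \<nu> k"
proof -
  note \<mu> = \<open>\<mu> = density lborel (\<lambda>x. ennreal (\<mu>_bar x))\<close>
  note \<nu> = \<open>\<nu> = density lborel (\<lambda>y. ennreal (\<nu>_bar y))\<close>
  have meas: "X_ge X c y l \<in> sets borel" if "y \<in> Y" for y l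
    by (rule X_ge_borel[OF \<open>open X\<close> Dy_continuous_on[OF assms(6) that]])
  have "X_ge X c y0 (k y0) \<subseteq> X_gt X c y1 (k y1)" if y: "y0 \<in> Y" "y1 \<in> Y" "y0 < y1" for y0 y1
  proof -
    define A where "A = X_ge X c y0 (k y0)"
    define K where "K = k_max X c y0 y1 (k y0)"
    define S where "S = S_min X c y0 y1 (k y0)"
    define r where "r = Linf_norm S \<mu>_bar * (D_vol_min X c y0 y1 (k y0) / ennreal (y1 - y0))"
    have S_eq: "S = X_ge X c y1 K - A"
      by (simp add: S_def S_min_def A_def K_def)
    have AK: "A \<subseteq> X_ge X c y1 K"
      unfolding A_def K_def by (rule X_ge_subset_k_max)
    have [measurable]: "A \<in> sets borel" "S \<in> sets borel"
      using meas y by (auto simp: A_def S_eq)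
    \<comment> \<open>With \<open>y1\<close> fixed, \<open>r\<close> does not depend on
      \<open>y\<close>, and the supremum over \<open>y\<close> alone is at most the one over all
      pairs in the hypothesis.\<close>
    have "(SUP y \<in> {y0..y1}. enn2ereal r - ereal (\<nu>_bar y)) < 0"
    proof (rule le_less_trans[OF _ assms(20)[OF \<open>y0 \<in> Y\<close>]], rule SUP_least)
      fix y assume "y \<in> {y0..y1}"
      then show "enn2ereal r - ereal (\<nu>_bar y) \<le>
        (SUP (y1, y) \<in> {(y1, y). y1 \<in> Y \<and> y1 > y0 \<and> y0 \<le> y \<and> y \<le> y1}.
         enn2ereal (Linf_norm (S_min X c y0 y1 (k y0)) \<mu>_bar *
                    (D_vol_min X c y0 y1 (k y0) / ennreal (y1 - y0))) - ereal (\<nu>_bar y))"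
        using y by (intro SUP_upper2[of "(y1, y)"]) (auto simp: r_def S_def)
    qed
    then have "r * ennreal (y1 - y0) < emeasure \<nu> {y0<..y1}"
      unfolding \<nu> using assms(15) y by (intro emeasure_density_Ioc_greater) auto
    moreover have "emeasure \<mu> S \<le> r * ennreal (y1 - y0)"
    proof -
      have "emeasure \<mu> S \<le> Linf_norm S \<mu>_bar * emeasure lborel S"
        unfolding \<mu> by (rule emeasure_density_le_Linf_norm) (use assms(11) in auto)
      \<comment> \<open>The factor \<open>y1 - y0\<close> is positive and finite, so it cancels in
        \<open>ennreal\<close> even if the volume were infinite.\<close>
      also have "emeasure lborel S = D_vol_min X c y0 y1 (k y0) / ennreal (y1 - y0) * ennreal (y1 - y0)"
        using y by (simp add: S_def D_vol_min_def ennreal_divide_times ennreal_mult_divide_eq)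
      finally show ?thesis
        by (simp add: r_def mult.assoc)
    qed
    ultimately have S_less: "emeasure \<mu> S < emeasure \<nu> {y0<..y1}"
      by order
    have A_mass: "emeasure \<mu> A = emeasure \<nu> {..y0}"
      using assms(19) y by (simp add: mass_splitting_def A_def)
    have "emeasure \<mu> (X_ge X c y1 K) = emeasure \<mu> (A \<union> S)"
      using AK by (simp add: S_eq Un_absorb1)
    also have "\<dots> = emeasure \<mu> A + emeasure \<mu> S"
      by (subst plus_emeasure) (auto simp: \<mu> S_eq[symmetric], auto simp: S_eq)
    \<comment> \<open>Adding the mass of \<open>{..y0}\<close> keeps the inequality strict because
      that mass is finite, being at most 1.\<close>
    also have "\<dots> < emeasure \<nu> {..y0} + emeasure \<nu> {y0<..y1}"
      unfolding A_mass using S_less prob_space.emeasure_le_1[OF assms(10)]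
      by (metis ennreal_add_left_cancel_less ennreal_one_neq_top infinity_ennreal_def neq_top_trans)
    also have "\<dots> = emeasure \<nu> ({..y0} \<union> {y0<..y1})"
      by (rule plus_emeasure) (auto simp: \<nu>)
    also have "{..y0} \<union> {y0<..y1} = {..y1}"
      using y by auto
    also have "emeasure \<nu> {..y1} = emeasure \<mu> (X_ge X c y1 (k y1))"
      using assms(19) y by (simp add: mass_splitting_def)
    finally have less: "emeasure \<mu> (X_ge X c y1 K) < emeasure \<mu> (X_ge X c y1 (k y1))" .
    \<comment> \<open>Superlevel sets shrink as the level grows, so \<open>K \<le> k y1\<close>
      would reverse the strict comparison of masses.\<close>
    have "k y1 < K"
    proof (rule ccontr)
      assume "\<not> k y1 < K"
      then have "X_ge X c y1 (k y1) \<subseteq> X_ge X c y1 K"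
        by (auto simp: X_ge_def not_less intro: order_trans[of K "ereal (k y1)"])
      then have "emeasure \<mu> (X_ge X c y1 (k y1)) \<le> emeasure \<mu> (X_ge X c y1 K)"
        using meas y by (intro emeasure_mono) (auto simp: \<mu>)
      with less show False by simp
    qed
    \<comment> \<open>The strict gap between the levels places the superlevel set at
      \<open>K\<close>, and \<open>A\<close> inside it, off the level set of
      \<open>k y1\<close>.\<close>
    then have "ereal (k y1) < Dy c x y1" if "K \<le> ereal (Dy c x y1)" for x
      using that by (rule less_le_trans)
    then have "X_ge X c y1 K \<subseteq> X_gt X c y1 (k y1)"
      by (fastforce simp: X_ge_def X_gt_def X_eq_def)
    with AK show ?thesis
      by (simp add: A_def)
  qed
  then show ?thesis
    by (simp add: nested_def)
qed

end
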